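(* Let $1\le p<\infty$ and let $u,w$ be nonnegative functions on $\mathbb{R}^n$, with $u$ locally integrable. For measurable $f$ on $\mathbb{R}^n$ put $$\|f\|_{\mathcal L^{p}(u,w)} := \sup_{B}\left(\frac 1{u(B)}\int_{B}|f|^p w\right)^{1/p},$$ where the supremum is taken over all balls $B$ in $\mathbb{R}^n$. (1) If $u$ is doubling, then taking the supremum only over balls of type I and type II gives a value equivalent to $\|f\|_{\mathcal L^{p}(u,w)}$ (with constants of equivalence independent of $f$). (2) If moreover there are $a\in(0,1)$ and a constant $C$ independent of $R$ such that $$\sum_{j=0}^\infty u(B(0,a^jR))\le C\, u(B(0,R))\qquad\text{for all } R>0,$$ then taking the supremum only over balls of type II gives a value equivalent to $\|f\|_{\mathcal L^{p}(u,w)}$ (with constants of equivalence independent of $f$).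
   Context: $B(x,r)$ is the Euclidean ball with center $x\in\mathbb{R}^n$ and radius $r>0$; $u(B)=\int_B u$. The function $u$ is doubling if $0<u(B)<\infty$ for every ball $B$ and there is a constant $C$ with $u(B(x,2r))\le C\,u(B(x,r))$ for all $x\in\mathbb{R}^n$, $r>0$. Two quantities are equivalent if each is at most a constant times the other. Types of balls: - Type I: balls centered at the origin. - Type II: balls $B(x,r)$ with $x\neq 0$ and $r\le |x|/4$. - Type III: balls $B(x,r)$ with $x\ne 0$ and $r>|x|/4$. *)

theory Defs
  imports "HOL-Analysis.Analysis"
begin

definition locally_integrable :: "(real^'n \<Rightarrow> real) \<Rightarrow> bool" where
  "locally_integrable u \<longleftrightarrow> (\<forall>K. compact K \<longrightarrow> set_integrable lebesgue K u)"

definition weight_mass :: "(real^'n \<Rightarrow> real) \<Rightarrow> (real^'n) set \<Rightarrow> ennreal" where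
  "weight_mass u B = (\<integral>\<^sup>+x\<in>B. ennreal (u x) \<partial>lebesgue)"

definition doubling :: "(real^'n \<Rightarrow> real) \<Rightarrow> bool" where
  "doubling u \<longleftrightarrow>
     (\<forall>x r. 0 < r \<longrightarrow> 0 < weight_mass u (ball x r) \<and> weight_mass u (ball x r) < \<infinity>) \<and>
     (\<exists>C::real. 0 < C \<and> (\<forall>x r. 0 < r \<longrightarrow>
        weight_mass u (ball x (2 * r)) \<le> ennreal C * weight_mass u (ball x r)))"

definition all_balls :: "(real^'n) set set" where
  "all_balls = {ball x r | x r. 0 < r}"

definition type_I_balls :: "(real^'n) set set" where
  "type_I_balls = {ball 0 r | r. 0 < r}"

definition type_II_balls :: "(real^'n) set set" where
  "type_II_balls = {ball x r | x r. x \<noteq> 0 \<and> 0 < r \<and> r \<le> norm x / 4}"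

text \<open>Real powers on \<open>[0, \<infinity>]\<close> with \<open>\<infinity>\<close> mapped to \<open>\<infinity>\<close>;
  meaningful for exponents \<open>a > 0\<close> only.\<close>

definition ennreal_powr :: "ennreal \<Rightarrow> real \<Rightarrow> ennreal" where
  "ennreal_powr x a = (if x = \<infinity> then \<infinity> else ennreal (enn2real x powr a))"

text \<open>The supremum is taken in \<open>[0, \<infinity>]\<close>, over an arbitrary family of balls; the Morrey norm
  \<open>\<parallel>f\<parallel>\<close> itself is the case of \<^const>\<open>all_balls\<close>.\<close>

definition morrey_sup ::
  "real \<Rightarrow> (real^'n \<Rightarrow> real) \<Rightarrow> (real^'n \<Rightarrow> real) \<Rightarrow> (real^'n) set set \<Rightarrow> (real^'n \<Rightarrow> complex) \<Rightarrow> ennreal"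
where
  "morrey_sup p u w \<B> f =
     (SUP B\<in>\<B>. ennreal_powr
        (1 / weight_mass u B * (\<integral>\<^sup>+x\<in>B. ennreal (norm (f x) powr p * w x) \<partial>lebesgue))
        (1 / p))"

abbreviation morrey_norm ::
  "real \<Rightarrow> (real^'n \<Rightarrow> real) \<Rightarrow> (real^'n \<Rightarrow> real) \<Rightarrow> (real^'n \<Rightarrow> complex) \<Rightarrow> ennreal"
where
  "morrey_norm p u w \<equiv> morrey_sup p u w all_balls"

text \<open>Equivalence of two quantities depending on a parameter ranging over \<open>S\<close>, with finite
  constants that do not depend on the parameter.\<close>

definition equivalent_on :: "'a set \<Rightarrow> ('a \<Rightarrow> ennreal) \<Rightarrow> ('a \<Rightarrow> ennreal) \<Rightarrow> bool" where
  "equivalent_on S F G \<longleftrightarrow>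
     (\<exists>C::real. 0 < C \<and> (\<forall>f\<in>S. F f \<le> ennreal C * G f)) \<and>
     (\<exists>C::real. 0 < C \<and> (\<forall>f\<in>S. G f \<le> ennreal C * F f))"

end

theory Submission imports Defs begin

text \<open>
  Everything reduces to transferring bounds \<open>\<nu>(B) \<le> T u(B)\<close>, where \<open>\<nu> = |f|\<^sup>p w dx\<close>, from a subfamily of
  balls to all balls. If \<open>|x| < 4r\<close>, then \<open>B(x,r) \<subseteq> B(0,5r) \<subseteq> B(x,16r)\<close>, and doubling compares
  the \<open>u\<close>-masses. A ball \<open>B(0,R)\<close> is, up to its centre, the union of the annuli
  \<open>a\<^sup>j\<^sup>+\<^sup>1R \<le> |x| < a\<^sup>jR\<close>; by scaling, each is covered by the same number \<open>N\<close> of balls of type II contained in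
  \<open>B(0,2a\<^sup>jR)\<close>, so that \<open>\<nu>(B(0,R)) \<le> N C T \<Sum>\<^sub>j u(B(0,a\<^sup>jR))\<close>.
\<close>

section \<open>Division and real powers in [0, \<infinity>]\<close>

lemma ennreal_divide_le_iff:
  fixes b c t :: ennreal
  assumes "0 < c" "c < \<infinity>"
  shows "b / c \<le> t \<longleftrightarrow> b \<le> t * c"
proof
  assume "b / c \<le> t"
  then have "b / c * c \<le> t * c" by (rule mult_right_mono) simp
  then show "b \<le> t * c" using assms by (simp add: ennreal_divide_times)
next
  assume "b \<le> t * c"
  then show "b / c \<le> t"
    using assms by (intro divide_le_posI_ennreal) (simp_all add: mult.commute)
qed

lemma ennreal_powr_mono:
  assumes "x \<le> y" "0 < a"
  shows "ennreal_powr x a \<le> ennreal_powr y a"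
proof (cases "y = \<infinity>")
  case False
  then have "enn2real x \<le> enn2real y" "x \<noteq> \<infinity>"
    using assms by (auto simp: enn2real_mono less_top top_unique)
  then show ?thesis
    using False assms by (auto simp: ennreal_powr_def intro!: ennreal_leI powr_mono2)
qed (simp add: ennreal_powr_def)

lemma ennreal_powr_powr_inverse:
  assumes "0 < a"
  shows "ennreal_powr (ennreal_powr x (1 / a)) a = x"
  using assms by (cases x) (auto simp: ennreal_powr_def powr_powr)

text \<open>With \<open>a = p\<close> this is how a factor \<open>K\<close> between masses becomes
  the factor \<open>K powr (1 / p)\<close> between norms, infinite values included.\<close>

lemma ennreal_powr_mult_powr_inverse:
  assumes "0 < a" "0 < K"
  shows "ennreal_powr (ennreal K * ennreal_powr x a) (1 / a) = ennreal (K powr (1 / a)) * x"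
proof (cases x)
  case (real t)
  then show ?thesis using assms
    by (simp add: ennreal_powr_def powr_powr powr_mult flip: ennreal_mult)
qed (use assms in \<open>simp add: ennreal_powr_def ennreal_mult_eq_top_iff ennreal_mult_top\<close>)

section \<open>Masses of balls under doubling\<close>

lemma weight_mass_mono:
  assumes "A \<subseteq> B"
  shows "weight_mass u A \<le> weight_mass u B"
  unfolding weight_mass_def using assms
  by (intro nn_integral_mono) (auto simp: indicator_def)

lemma weight_mass_ball_pos_finite:
  assumes "doubling u" "0 < r"
  shows "0 < weight_mass u (ball x r)" "weight_mass u (ball x r) < \<infinity>"
  using assms by (auto simp: doubling_def)

lemma doublingE:
  assumes "doubling u"
  obtains C :: real where "0 < C"
    "\<And>x r. 0 < r \<Longrightarrow> weight_mass u (ball x (2 * r)) \<le> ennreal C * weight_mass u (ball x r)"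
  using assms by (auto simp: doubling_def)

lemma doubling_iterate:
  assumes "\<And>x r. 0 < r \<Longrightarrow> weight_mass u (ball x (2 * r)) \<le> ennreal C * weight_mass u (ball x r)"
    and "0 < r"
  shows "weight_mass u (ball x (2 ^ k * r)) \<le> ennreal C ^ k * weight_mass u (ball x r)"
proof (induction k)
  case (Suc k)
  have "weight_mass u (ball x (2 ^ Suc k * r)) \<le> ennreal C * weight_mass u (ball x (2 ^ k * r))"
    using assms(1)[of "2 ^ k * r" x] assms(2) by (simp add: mult.assoc)
  also have "\<dots> \<le> ennreal C * (ennreal C ^ k * weight_mass u (ball x r))"
    by (intro mult_left_mono Suc) simp
  finally show ?case by (simp add: mult.assoc)
qed simp

text \<open>Quantifying over measures \<nu> and factors \<open>T\<close> after \<open>K\<close>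
  makes \<open>K\<close> depend on \<open>u\<close> alone; this later yields constants independent
  of \<open>f\<close>.\<close>

lemma bound_all_balls_from_type_I_II:
  fixes u :: "real^'n \<Rightarrow> real"
  assumes "doubling u"
  obtains K :: real where "1 \<le> K"
    "\<And>\<nu> T B. \<lbrakk>sets \<nu> = sets lebesgue;
        \<And>B. B \<in> type_I_balls \<union> type_II_balls \<Longrightarrow> emeasure \<nu> B \<le> T * weight_mass u B;
        B \<in> all_balls\<rbrakk> \<Longrightarrow> emeasure \<nu> B \<le> ennreal K * T * weight_mass u B"
proof -
  obtain C :: real where "0 < C" and C: "\<And>x r. 0 < r \<Longrightarrow>
      weight_mass u (ball x (2 * r)) \<le> ennreal C * weight_mass u (ball x r)"
    using doublingE[OF assms] by blast
  show thesis
  \<comment> \<open>The maximum with 1 serves the balls already of type I or II; the power 4 stands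
    for the four doublings from \<open>r\<close> to \<open>16 * r\<close>.\<close>
  proof (rule that[of "max 1 (C ^ 4)"])
    fix \<nu> T and B :: "(real^'n) set"
    assume sets: "sets \<nu> = sets lebesgue" and B: "B \<in> all_balls"
      and bound: "\<And>B. B \<in> type_I_balls \<union> type_II_balls \<Longrightarrow> emeasure \<nu> B \<le> T * weight_mass u B"
    obtain x r where Bxr: "B = ball x r" "0 < r" using B by (auto simp: all_balls_def)
    show "emeasure \<nu> B \<le> ennreal (max 1 (C ^ 4)) * T * weight_mass u B"
    proof (cases "B \<in> type_I_balls \<union> type_II_balls")
      case True
      have "emeasure \<nu> B \<le> 1 * T * weight_mass u B" using bound[OF True] by simp
      also have "\<dots> \<le> ennreal (max 1 (C ^ 4)) * T * weight_mass u B"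
        by (intro mult_right_mono) auto
      finally show ?thesis .
    next
      case False
      then have far: "norm x < 4 * r"
        using Bxr unfolding type_I_balls_def type_II_balls_def by fastforce
      \<comment> \<open>From |x| < 4r follow |x| + r < 5r and |x| + 5r < 9r; 16 is the first power
        of 2 that is at least 9.\<close>
      have sub1: "B \<subseteq> ball 0 (5 * r)" and sub2: "ball 0 (5 * r) \<subseteq> ball x (2 ^ 4 * r)"
        using far Bxr by (auto simp: ball_subset_ball_iff)
      have "emeasure \<nu> B \<le> emeasure \<nu> (ball 0 (5 * r))"
        using sub1 by (intro emeasure_mono) (auto simp: sets)
      also have "\<dots> \<le> T * weight_mass u (ball 0 (5 * r))"
        using Bxr by (intro bound) (auto simp: type_I_balls_def)
      also have "\<dots> \<le> T * weight_mass u (ball x (2 ^ 4 * r))"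
        by (intro mult_left_mono weight_mass_mono sub2) simp
      also have "\<dots> \<le> T * (ennreal C ^ 4 * weight_mass u B)"
        unfolding Bxr(1) by (intro mult_left_mono doubling_iterate C Bxr) auto
      also have "\<dots> = ennreal (C ^ 4) * T * weight_mass u B"
        using \<open>0 < C\<close> by (simp add: ennreal_power ac_simps)
      also have "\<dots> \<le> ennreal (max 1 (C ^ 4)) * T * weight_mass u B"
        by (intro mult_right_mono ennreal_leI) auto
      finally show ?thesis .
    qed
  qed simp
qed

section \<open>Covering a punctured ball by balls of type II\<close>

lemma annulus_finite_cover:
  fixes a :: real
  assumes "0 < a"
  obtains F :: "'a::euclidean_space set" where "finite F"
    "\<And>y. y \<in> F \<Longrightarrow> a \<le> norm y \<and> norm y \<le> 1"
    "\<And>x. \<lbrakk>a \<le> norm x; norm x \<le> 1\<rbrakk> \<Longrightarrow> \<exists>y\<in>F. x \<in> ball y (a / 4)"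
proof -
  let ?A = "{x::'a. a \<le> norm x \<and> norm x \<le> 1}"
  have "?A = cball 0 1 - ball 0 a" by auto
  then have "compact ?A" by (simp add: compact_diff)
  then obtain F where "F \<subseteq> ?A" "finite F" "?A \<subseteq> (\<Union>y\<in>F. ball y (a / 4))"
    by (rule compactE_image[where C = ?A and f = "\<lambda>y. ball y (a / 4)"]) (use assms in auto)
  then show thesis by (intro that[of F]) blast+
qed

text \<open>The sequence \<open>a ^ n * R\<close> starts above \<open>t\<close> and tends to 0, so
  it crosses \<open>t\<close> between two consecutive indices. With \<open>t = norm x\<close> this
  finds the annulus containing \<open>x\<close>.\<close>

lemma geometric_annulus_exists:
  fixes a t R :: real
  assumes "0 < a" "a < 1" "0 < t" "t < R"
  obtains j where "a ^ Suc j * R \<le> t" "t < a ^ j * R"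
proof -
  obtain n where n: "a ^ n < t / R"
    using real_arch_pow_inv[of "t / R" a] assms by auto
  let ?P = "\<lambda>n. a ^ n * R \<le> t"
  have P: "?P n" using n assms by (simp add: field_simps)
  moreover have "\<not> ?P 0" using assms by simp
  ultimately obtain j where "\<not> ?P j" "?P (Suc j)"
    using exists_least_lemma[of ?P] by blast
  then show thesis by (intro that[of j]) auto
qed

text \<open>The constant is \<open>N * C * S\<close>: \<open>N\<close> bounds the number of covering
  balls per annulus, \<open>C\<close> pays for one doubling of the ball about 0, and
  \<open>S\<close> sums the masses over the annuli. The condition on \<open>{0}\<close> handles the
  centre, which no ball of type II contains.\<close>

lemma bound_type_I_from_type_II:
  fixes u :: "real^'n \<Rightarrow> real"
  assumes "doubling u" "0 < a" "a < 1" "0 < S"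
    and S: "\<And>R. 0 < R \<Longrightarrow>
      (\<Sum>j. weight_mass u (ball 0 (a ^ j * R))) \<le> ennreal S * weight_mass u (ball 0 R)"
  obtains K :: real where "0 < K"
    "\<And>\<nu> T R. \<lbrakk>sets \<nu> = sets lebesgue; emeasure \<nu> {0} = 0;
        \<And>B. B \<in> type_II_balls \<Longrightarrow> emeasure \<nu> B \<le> T * weight_mass u B; 0 < R\<rbrakk>
      \<Longrightarrow> emeasure \<nu> (ball 0 R) \<le> ennreal K * T * weight_mass u (ball 0 R)"
proof -
  obtain C :: real where "0 < C" and C: "\<And>x r. 0 < r \<Longrightarrow>
      weight_mass u (ball x (2 * r)) \<le> ennreal C * weight_mass u (ball x r)"
    using doublingE[OF assms(1)] by blast
  obtain F :: "(real^'n) set" where "finite F"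
    and F: "\<And>y. y \<in> F \<Longrightarrow> a \<le> norm y \<and> norm y \<le> 1"
    and cover: "\<And>x. \<lbrakk>a \<le> norm x; norm x \<le> 1\<rbrakk> \<Longrightarrow> \<exists>y\<in>F. x \<in> ball y (a / 4)"
    using annulus_finite_cover[OF \<open>0 < a\<close>] by blast
  \<comment> \<open>The successor makes \<open>N\<close> positive without an argument that
    \<open>F\<close> is nonempty.\<close>
  define N where "N = real (Suc (card F))"
  have "0 < N" by (simp add: N_def)
  show thesis
  proof (rule that[of "N * C * S"])
    show "0 < N * C * S" using \<open>0 < N\<close> \<open>0 < C\<close> \<open>0 < S\<close> by simp
  next
    fix \<nu> T and R :: real
    assume sets: "sets \<nu> = sets lebesgue" and zero: "emeasure \<nu> {0} = 0" and "0 < R"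
      and bound: "\<And>B. B \<in> type_II_balls \<Longrightarrow> emeasure \<nu> B \<le> T * weight_mass u B"
    \<comment> \<open>\<open>s j\<close> is the outer radius of the annulus number \<open>j\<close>,
      and \<open>U j\<close> is the cover of the unit annulus dilated by \<open>s j\<close>.\<close>
    define s where "s j = a ^ j * R" for j
    have s: "0 < s j" for j using \<open>0 < a\<close> \<open>0 < R\<close> by (simp add: s_def)
    define U where "U j = (\<Union>y\<in>F. ball (s j *\<^sub>R y) (s j * a / 4))" for j
    have U_sets: "U j \<in> sets \<nu>" for j
      unfolding sets U_def by (intro sets_completionI_sets) (simp add: borel_open open_UN)
    have U_bound: "emeasure \<nu> (U j) \<le> ennreal N * (T * (ennreal C * weight_mass u (ball 0 (s j))))" for j
    proof -
      have "emeasure \<nu> (U j) \<le> (\<Sum>y\<in>F. emeasure \<nu> (ball (s j *\<^sub>R y) (s j * a / 4)))"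
        unfolding U_def by (intro emeasure_subadditive_finite \<open>finite F\<close>) (auto simp: sets)
      also have "\<dots> \<le> (\<Sum>y\<in>F. T * (ennreal C * weight_mass u (ball 0 (s j))))"
      proof (rule sum_mono)
        fix y assume "y \<in> F"
        note y = F[OF this]
        \<comment> \<open>Type II survives the dilation: \<open>a \<le> norm y\<close> gives
          \<open>s j * a / 4 \<le> norm (s j *\<^sub>R y) / 4\<close>.\<close>
        have II: "ball (s j *\<^sub>R y) (s j * a / 4) \<in> type_II_balls"
          unfolding type_II_balls_def using s[of j] y \<open>0 < a\<close>
          by (intro CollectI exI[of _ "s j *\<^sub>R y"] exI[of _ "s j * a / 4"]) auto
        \<comment> \<open>A crude bound is enough: radius \<open>2 * s j\<close> costs exactly one
          doubling from \<open>s j\<close>.\<close>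
        have "norm (s j *\<^sub>R y) + s j * a / 4 \<le> s j * 1 + s j * 1"
        proof (intro add_mono)
          show "norm (s j *\<^sub>R y) \<le> s j * 1" using y s[of j] by simp
          have "s j * (a / 4) \<le> s j * 1"
            using s[of j] \<open>a < 1\<close> by (intro mult_left_mono) auto
          then show "s j * a / 4 \<le> s j * 1" by simp
        qed
        then have sub: "ball (s j *\<^sub>R y) (s j * a / 4) \<subseteq> ball 0 (2 * s j)"
          by (simp add: ball_subset_ball_iff)
        have "emeasure \<nu> (ball (s j *\<^sub>R y) (s j * a / 4))
            \<le> T * weight_mass u (ball (s j *\<^sub>R y) (s j * a / 4))"
          by (rule bound[OF II])
        also have "\<dots> \<le> T * weight_mass u (ball 0 (2 * s j))"
          by (intro mult_left_mono weight_mass_mono sub) simp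
        also have "\<dots> \<le> T * (ennreal C * weight_mass u (ball 0 (s j)))"
          by (intro mult_left_mono C s) simp
        finally show "emeasure \<nu> (ball (s j *\<^sub>R y) (s j * a / 4))
            \<le> T * (ennreal C * weight_mass u (ball 0 (s j)))" .
      qed
      also have "\<dots> = ennreal (card F) * (T * (ennreal C * weight_mass u (ball 0 (s j))))"
        by (simp add: ennreal_of_nat_eq_real_of_nat)
      also have "\<dots> \<le> ennreal N * (T * (ennreal C * weight_mass u (ball 0 (s j))))"
        by (intro mult_right_mono ennreal_leI) (auto simp: N_def)
      finally show ?thesis .
    qed
    have sub: "ball 0 R \<subseteq> {0} \<union> (\<Union>j. U j)"
    proof
      fix x :: "real^'n" assume x: "x \<in> ball 0 R"
      show "x \<in> {0} \<union> (\<Union>j. U j)"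
      proof (cases "x = 0")
        case False
        then obtain j where j: "a ^ Suc j * R \<le> norm x" "norm x < a ^ j * R"
          using geometric_annulus_exists[of a "norm x" R] x \<open>0 < a\<close> \<open>a < 1\<close> by auto
        \<comment> \<open>Rescaling moves \<open>x\<close> into the unit annulus, where
          \<open>F\<close> provides a nearby centre \<open>y\<close>; dilating back multiplies the
          distance by \<open>s j\<close>.\<close>
        let ?z = "(1 / s j) *\<^sub>R x"
        have "a \<le> norm ?z" "norm ?z \<le> 1"
          using j s[of j] by (auto simp: s_def field_simps)
        then obtain y where y: "y \<in> F" "dist y ?z < a / 4" using cover[of ?z] by auto
        have "dist (s j *\<^sub>R y) x = dist (s j *\<^sub>R y) (s j *\<^sub>R ?z)" using s[of j] by simp
        also have "\<dots> = s j * dist y ?z" using s[of j]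
          unfolding dist_norm scaleR_diff_right[symmetric] by simp
        also have "\<dots> < s j * (a / 4)" using y s by (intro mult_strict_left_mono) auto
        finally have "x \<in> U j" using y by (auto simp: U_def)
        then show ?thesis by blast
      qed simp
    qed
    have zero_sets: "{0} \<in> sets \<nu>" by (simp add: sets)
    have UU_sets: "(\<Union>j. U j) \<in> sets \<nu>" using U_sets by blast
    have "emeasure \<nu> (ball 0 R) \<le> emeasure \<nu> ({0} \<union> (\<Union>j. U j))"
      by (intro emeasure_mono sub sets.Un zero_sets UU_sets)
    also have "\<dots> \<le> emeasure \<nu> {0} + emeasure \<nu> (\<Union>j. U j)"
      by (intro emeasure_subadditive zero_sets UU_sets)
    also have "\<dots> \<le> (\<Sum>j. emeasure \<nu> (U j))"
      unfolding zero using emeasure_subadditive_countably[of U \<nu>] U_sets by auto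
    also have "\<dots> \<le> (\<Sum>j. ennreal N * (T * (ennreal C * weight_mass u (ball 0 (s j)))))"
      by (intro suminf_le U_bound) auto
    also have "\<dots> = ennreal N * (T * (ennreal C * (\<Sum>j. weight_mass u (ball 0 (s j)))))"
      by simp
    also have "\<dots> \<le> ennreal N * (T * (ennreal C * (ennreal S * weight_mass u (ball 0 R))))"
      unfolding s_def by (intro mult_left_mono S \<open>0 < R\<close>) auto
    also have "\<dots> = ennreal (N * C * S) * T * weight_mass u (ball 0 R)"
      using \<open>0 < N\<close> \<open>0 < C\<close> \<open>0 < S\<close> by (simp add: ennreal_mult ac_simps)
    finally show "emeasure \<nu> (ball 0 R) \<le> ennreal (N * C * S) * T * weight_mass u (ball 0 R)" .
  qed
qed

text \<open>The transfer hypothesis is applied to the measure with density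
  \<open>norm (f x) powr p * w x\<close> and to \<open>T = ennreal_powr M p\<close>, where
  \<open>M\<close> is the supremum over the subfamily; taking p-th roots gives the constant
  \<open>K powr (1 / p)\<close>. The converse inequality is monotonicity of the supremum.\<close>

lemma equivalent_on_morrey_normI:
  fixes u w :: "real^'n \<Rightarrow> real"
  assumes "1 \<le> p" "w \<in> borel_measurable lebesgue" "doubling u"
    and sub: "\<B> \<subseteq> all_balls" and "0 < K"
    and K: "\<And>\<nu> T B. \<lbrakk>sets \<nu> = sets lebesgue; emeasure \<nu> {0} = 0;
        \<And>B. B \<in> \<B> \<Longrightarrow> emeasure \<nu> B \<le> T * weight_mass u B; B \<in> all_balls\<rbrakk>
      \<Longrightarrow> emeasure \<nu> B \<le> ennreal K * T * weight_mass u B"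
  shows "equivalent_on (borel_measurable lebesgue) (morrey_sup p u w \<B>) (morrey_norm p u w)"
proof -
  have "morrey_norm p u w f \<le> ennreal (K powr (1 / p)) * morrey_sup p u w \<B> f"
    if f: "f \<in> borel_measurable lebesgue" for f :: "real^'n \<Rightarrow> complex"
  proof -
    define g where "g x = ennreal (norm (f x) powr p * w x)" for x
    define \<nu> where "\<nu> = density lebesgue g"
    define M where "M = morrey_sup p u w \<B> f"
    have g: "g \<in> borel_measurable lebesgue"
      unfolding g_def using f assms(2) by measurable
    have sets: "sets \<nu> = sets lebesgue" by (simp add: \<nu>_def)
    have \<nu>: "emeasure \<nu> B = (\<integral>\<^sup>+x\<in>B. g x \<partial>lebesgue)" if "B \<in> sets lebesgue" for B
      unfolding \<nu>_def using g that by (rule emeasure_density)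
    \<comment> \<open>A point is Lebesgue null, and \<nu> has a density with respect to Lebesgue
      measure.\<close>
    have zero: "emeasure \<nu> {0} = 0"
    proof -
      have "{0 :: real^'n} \<in> null_sets lebesgue" by (simp add: null_sets_completionI)
      then show ?thesis using g by (auto simp: \<nu> intro: nn_integral_null_set)
    qed
    \<comment> \<open>Since \<open>0 < u(B) < \<infinity>\<close>, bounds on averages and bounds on
      masses are interchangeable, even for infinite \<open>T\<close>.\<close>
    have quot: "1 / weight_mass u B * (\<integral>\<^sup>+x\<in>B. g x \<partial>lebesgue) \<le> T
        \<longleftrightarrow> emeasure \<nu> B \<le> T * weight_mass u B" if B: "B \<in> all_balls" for B T
    proof -
      obtain x r where "B = ball x r" "0 < r" using B by (auto simp: all_balls_def)
      then have "0 < weight_mass u B" "weight_mass u B < \<infinity>" "B \<in> sets lebesgue"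
        using weight_mass_ball_pos_finite[OF \<open>doubling u\<close>] by auto
      then show ?thesis
        by (simp add: \<nu> ennreal_divide_le_iff ennreal_divide_times)
    qed
    have "emeasure \<nu> B \<le> ennreal_powr M p * weight_mass u B" if "B \<in> \<B>" for B
    proof -
      have "ennreal_powr (1 / weight_mass u B * (\<integral>\<^sup>+x\<in>B. g x \<partial>lebesgue)) (1 / p) \<le> M"
        unfolding M_def morrey_sup_def g_def using that by (rule SUP_upper)
      then have "1 / weight_mass u B * (\<integral>\<^sup>+x\<in>B. g x \<partial>lebesgue) \<le> ennreal_powr M p"
        using ennreal_powr_mono[of _ M p] ennreal_powr_powr_inverse[of p] \<open>1 \<le> p\<close> by fastforce
      then show ?thesis using quot sub that by blast
    qed
    then have bound: "emeasure \<nu> B \<le> ennreal K * ennreal_powr M p * weight_mass u B"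
      if "B \<in> all_balls" for B
      using K sets zero that by blast
    show ?thesis
      unfolding morrey_sup_def[of p u w all_balls]
    proof (rule SUP_least)
      fix B :: "(real^'n) set" assume "B \<in> all_balls"
      then have "1 / weight_mass u B * (\<integral>\<^sup>+x\<in>B. g x \<partial>lebesgue) \<le> ennreal K * ennreal_powr M p"
        using quot bound by blast
      then have "ennreal_powr (1 / weight_mass u B * (\<integral>\<^sup>+x\<in>B. g x \<partial>lebesgue)) (1 / p)
          \<le> ennreal_powr (ennreal K * ennreal_powr M p) (1 / p)"
        using \<open>1 \<le> p\<close> by (intro ennreal_powr_mono) auto
      then show "ennreal_powr (1 / weight_mass u B *
            (\<integral>\<^sup>+x\<in>B. ennreal (norm (f x) powr p * w x) \<partial>lebesgue)) (1 / p)
          \<le> ennreal (K powr (1 / p)) * morrey_sup p u w \<B> f"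
        using \<open>1 \<le> p\<close> \<open>0 < K\<close> by (simp add: ennreal_powr_mult_powr_inverse g_def M_def)
    qed
  qed
  moreover have "morrey_sup p u w \<B> f \<le> ennreal 1 * morrey_norm p u w f" for f
    unfolding morrey_sup_def using sub by (simp add: SUP_subset_mono)
  ultimately show ?thesis
    unfolding equivalent_on_def using \<open>0 < K\<close>
    by (intro conjI exI[of _ 1] exI[of _ "K powr (1 / p)"]) auto
qed

section \<open>Equivalence of the restricted suprema with the full Morrey norm\<close>

theorem proposition2p1:
  fixes p :: real and u w :: "real^'n \<Rightarrow> real"
  assumes "1 \<le> p"
    and "\<And>x. 0 \<le> u x" and "locally_integrable u"
    and "\<And>x. 0 \<le> w x" and "w \<in> borel_measurable lebesgue"
  shows "(doubling u \<longrightarrow>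
            equivalent_on (borel_measurable lebesgue)
              (morrey_sup p u w (type_I_balls \<union> type_II_balls)) (morrey_norm p u w))
       \<and> (doubling u \<and>
          (\<exists>a\<in>{0<..<1}. \<exists>C::real. 0 < C \<and> (\<forall>R>0.
              (\<Sum>j. weight_mass u (ball 0 (a ^ j * R))) \<le> ennreal C * weight_mass u (ball 0 R)))
          \<longrightarrow> equivalent_on (borel_measurable lebesgue)
                (morrey_sup p u w type_II_balls) (morrey_norm p u w))"
proof (intro conjI impI)
  have sub: "type_I_balls \<union> type_II_balls \<subseteq> (all_balls :: (real^'n) set set)"
    by (auto simp: type_I_balls_def type_II_balls_def all_balls_def)
  {
    assume "doubling u"
    then obtain K where "1 \<le> K" and K: "\<And>\<nu> T B. \<lbrakk>sets \<nu> = sets lebesgue;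
        \<And>B. B \<in> type_I_balls \<union> type_II_balls \<Longrightarrow> emeasure \<nu> B \<le> T * weight_mass u B;
        B \<in> all_balls\<rbrakk> \<Longrightarrow> emeasure \<nu> B \<le> ennreal K * T * weight_mass u B"
      by (rule bound_all_balls_from_type_I_II) blast
    show "equivalent_on (borel_measurable lebesgue)
        (morrey_sup p u w (type_I_balls \<union> type_II_balls)) (morrey_norm p u w)"
      by (rule equivalent_on_morrey_normI[where K = K])
        (use assms \<open>doubling u\<close> sub \<open>1 \<le> K\<close> K in auto)
  next
    assume "doubling u \<and> (\<exists>a\<in>{0<..<1}. \<exists>C::real. 0 < C \<and> (\<forall>R>0.
      (\<Sum>j. weight_mass u (ball 0 (a ^ j * R))) \<le> ennreal C * weight_mass u (ball 0 R)))"
    then obtain a S :: real where "doubling u" and aS: "0 < a" "a < 1" "0 < S"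
      "\<And>R. 0 < R \<Longrightarrow>
        (\<Sum>j. weight_mass u (ball 0 (a ^ j * R))) \<le> ennreal S * weight_mass u (ball 0 R)"
      by auto
    obtain K where "1 \<le> K" and K: "\<And>\<nu> T B. \<lbrakk>sets \<nu> = sets lebesgue;
        \<And>B. B \<in> type_I_balls \<union> type_II_balls \<Longrightarrow> emeasure \<nu> B \<le> T * weight_mass u B;
        B \<in> all_balls\<rbrakk> \<Longrightarrow> emeasure \<nu> B \<le> ennreal K * T * weight_mass u B"
      by (rule bound_all_balls_from_type_I_II[OF \<open>doubling u\<close>]) blast
    obtain L where "0 < L" and L: "\<And>\<nu> T R. \<lbrakk>sets \<nu> = sets lebesgue; emeasure \<nu> {0} = 0;
        \<And>B. B \<in> type_II_balls \<Longrightarrow> emeasure \<nu> B \<le> T * weight_mass u B; 0 < R\<rbrakk>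
      \<Longrightarrow> emeasure \<nu> (ball 0 R) \<le> ennreal L * T * weight_mass u (ball 0 R)"
      by (rule bound_type_I_from_type_II[OF \<open>doubling u\<close> aS]) blast+
    show "equivalent_on (borel_measurable lebesgue)
        (morrey_sup p u w type_II_balls) (morrey_norm p u w)"
    \<comment> \<open>Two transfers are chained: \<open>L\<close> passes from type II to type I, the
      maximum with 1 keeps the type II balls themselves, and \<open>K\<close> passes to all
      balls.\<close>
    proof (rule equivalent_on_morrey_normI[where K = "K * max 1 L"])
      show "0 < K * max 1 L" using \<open>1 \<le> K\<close> by simp
    next
      fix \<nu> T and B :: "(real^'n) set"
      assume \<nu>: "sets \<nu> = sets lebesgue" "emeasure \<nu> {0} = 0" and B: "B \<in> all_balls"
        and II: "\<And>B. B \<in> type_II_balls \<Longrightarrow> emeasure \<nu> B \<le> T * weight_mass u B"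
      have "emeasure \<nu> B \<le> ennreal (max 1 L) * T * weight_mass u B"
        if "B \<in> type_I_balls \<union> type_II_balls" for B
        using that
      proof
        assume "B \<in> type_I_balls"
        then obtain R where "B = ball 0 R" "0 < R" by (auto simp: type_I_balls_def)
        then have "emeasure \<nu> B \<le> ennreal L * T * weight_mass u B" using L \<nu> II by blast
        also have "\<dots> \<le> ennreal (max 1 L) * T * weight_mass u B"
          by (intro mult_right_mono ennreal_leI) auto
        finally show ?thesis .
      next
        assume "B \<in> type_II_balls"
        then have "emeasure \<nu> B \<le> 1 * T * weight_mass u B" using II by simp
        also have "\<dots> \<le> ennreal (max 1 L) * T * weight_mass u B"
          by (intro mult_right_mono) auto
        finally show ?thesis .
      qed
      \<comment> \<open>The transfer to all balls is used here with the factor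
        \<open>ennreal (max 1 L) * T\<close> in the role of \<open>T\<close>.\<close>
      then have "emeasure \<nu> B \<le> ennreal K * (ennreal (max 1 L) * T) * weight_mass u B"
        using K \<nu>(1) B by blast
      then show "emeasure \<nu> B \<le> ennreal (K * max 1 L) * T * weight_mass u B"
        using \<open>1 \<le> K\<close> by (simp add: ennreal_mult mult.assoc)
    qed (use assms \<open>doubling u\<close> sub in auto)
  }
qed

end
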